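(* Let $d\ge 2$, $m\geq 1$ and $r$ be integers with $1\leq r<d$, and let $G(rd^{m},d)$ be the recursive circulant. (i) If $r\geq 4$ and $d\geq 5$, then $$rc(G(rd^{m},d))\leq src(G(rd^{m},d))\leq \begin{cases} \frac{d}{2}m + \lceil r/2\rceil & \text{if } d \text{ is even},\\ \lfloor \frac{d}{2}\rfloor m + \lceil r/2\rceil & \text{if } d \text{ is odd and } r=\lfloor \frac{d}{2}\rfloor,\\ (\lfloor \frac{d}{2}\rfloor+r)m+\lceil r/2\rceil & \text{if } d \text{ is odd and } r < \lfloor \frac{d}{2}\rfloor,\\ rm+\lceil r/2\rceil & \text{if } d \text{ is odd and } r>\lfloor\frac{d}{2}\rfloor. \end{cases}$$ In particular, if $d=2r+1$ and $r$ is even, then $rc(G(rd^{m},d))= src(G(rd^{m},d))=rm+r/2$. (ii) If $r\leq 3$ and $d\geq 4$, then $$rc(G(rd^{m},d))\leq src(G(rd^{m},d))\leq \begin{cases} \frac{d}{2}m + \lfloor r/2\rfloor & \text{if } d \text{ is even},\\ \lfloor \frac{d}{2}\rfloor m + \lfloor r/2\rfloor & \text{if } d \text{ is odd and } r=\lfloor \frac{d}{2}\rfloor,\\ (\lfloor \frac{d}{2}\rfloor+r)m+\lfloor r/2\rfloor & \text{if } d \text{ is odd and } r < \lfloor \frac{d}{2}\rfloor,\\ rm+\lfloor r/2\rfloor & \text{if } d \text{ is odd and } r>\lfloor\frac{d}{2}\rfloor. \end{cases}$$ In particular, if $r=3$ and $d=7$, then $rc(G(rd^{m},d))= src(G(rd^{m},d))=3m+1$.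 (iii) If $d=3$, then $rc(G(r3^{m},3))=src(G(r3^{m},3))=m+\lfloor r/2 \rfloor$. (iv) If $d=2$, then $\lfloor m/2\rfloor\leq rc(G(2^{m},2))\leq src(G(2^{m},2))\leq\lceil m/2 \rceil$. In particular, if $m$ is even, then $rc(G(2^{m},2))=src(G(2^{m},2))=m/2$.
   Context: All graphs are undirected, finite and simple. A path in an edge-colored graph (adjacent edges may have the same color) is a rainbow path if no two of its edges have the same color. The rainbow connection number $rc(G)$ of a connected graph $G$ is the minimum integer $i$ for which there is an $i$-edge-coloring of $G$ such that every two distinct vertices are connected by a rainbow path. The strong rainbow connection number $src(G)$ is the minimum integer $i$ for which there is an $i$-edge-coloring of $G$ such that every two distinct vertices $u,v$ are connected by a rainbow path of length $d(u,v)$, the distance between $u$ and $v$ in $G$. The recursive circulant $G(N,d)$ is the graph with vertex set $\{0,1,\ldots,N-1\}$ in which $v$ and $w$ are adjacent if and only if there exists $i$ with $0\leq i\leq \lceil\log_{d}N\rceil-1$ such that $v+d^{i}\equiv w \pmod N$ (edges being undirected). *)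

theory Defs
  imports Complex_Main "HOL-Number_Theory.Cong"
begin

record 'a ugraph =
  verts :: "'a set"
  edges :: "'a set set"

definition simple_graph :: "'a ugraph \<Rightarrow> bool" where
  "simple_graph G \<longleftrightarrow> finite (verts G) \<and> (\<forall>e\<in>edges G. e \<subseteq> verts G \<and> card e = 2)"

text \<open>A path is given by its list of vertices; its length is its number of edges.\<close>

definition path_edges :: "'a list \<Rightarrow> 'a set list" where
  "path_edges p = map (\<lambda>i. {p ! i, p ! Suc i}) [0..<length p - 1]"

definition is_path :: "'a ugraph \<Rightarrow> 'a \<Rightarrow> 'a list \<Rightarrow> 'a \<Rightarrow> bool" where
  "is_path G u p v \<longleftrightarrow>
     p \<noteq> [] \<and> hd p = u \<and> last p = v \<and> distinct p \<and>
     set p \<subseteq> verts G \<and> set (path_edges p) \<subseteq> edges G"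

definition path_length :: "'a list \<Rightarrow> nat" where
  "path_length p = length (path_edges p)"

definition connected_graph :: "'a ugraph \<Rightarrow> bool" where
  "connected_graph G \<longleftrightarrow> (\<forall>u\<in>verts G. \<forall>v\<in>verts G. \<exists>p. is_path G u p v)"

definition graph_dist :: "'a ugraph \<Rightarrow> 'a \<Rightarrow> 'a \<Rightarrow> nat" where
  "graph_dist G u v = (LEAST n. \<exists>p. is_path G u p v \<and> path_length p = n)"

definition edge_coloring :: "'a ugraph \<Rightarrow> nat \<Rightarrow> ('a set \<Rightarrow> nat) \<Rightarrow> bool" where
  "edge_coloring G k c \<longleftrightarrow> (\<forall>e\<in>edges G. c e \<in> {1..k})"

definition rainbow_path :: "('a set \<Rightarrow> nat) \<Rightarrow> 'a list \<Rightarrow> bool" where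
  "rainbow_path c p \<longleftrightarrow> distinct (map c (path_edges p))"

definition rainbow_connecting :: "'a ugraph \<Rightarrow> ('a set \<Rightarrow> nat) \<Rightarrow> bool" where
  "rainbow_connecting G c \<longleftrightarrow>
     (\<forall>u\<in>verts G. \<forall>v\<in>verts G. u \<noteq> v \<longrightarrow> (\<exists>p. is_path G u p v \<and> rainbow_path c p))"

definition strong_rainbow_connecting :: "'a ugraph \<Rightarrow> ('a set \<Rightarrow> nat) \<Rightarrow> bool" where
  "strong_rainbow_connecting G c \<longleftrightarrow>
     (\<forall>u\<in>verts G. \<forall>v\<in>verts G. u \<noteq> v \<longrightarrow>
        (\<exists>p. is_path G u p v \<and> rainbow_path c p \<and> path_length p = graph_dist G u v))"

text \<open>Both minima are attained when the graph is finite, simple and connected; see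
  \<open>strong_rainbow_connecting_exists\<close> below.\<close>

definition rc :: "'a ugraph \<Rightarrow> nat" where
  "rc G = (LEAST k. \<exists>c. edge_coloring G k c \<and> rainbow_connecting G c)"

definition src :: "'a ugraph \<Rightarrow> nat" where
  "src G = (LEAST k. \<exists>c. edge_coloring G k c \<and> strong_rainbow_connecting G c)"

text \<open>No condition \<open>v \<noteq> w\<close> is needed: the bound on \<open>i\<close> gives \<open>d ^ i < N\<close>,
  so there are no loops; see \<open>simple_graph_rec_circulant\<close> below.\<close>

definition rec_circulant :: "nat \<Rightarrow> nat \<Rightarrow> nat ugraph" where
  "rec_circulant N d =
     \<lparr> verts = {0..<N},
       edges = {{v, w} |v w. v < N \<and> w < N \<and>
         (\<exists>i::nat. int i \<le> \<lceil>log (real d) (real N)\<rceil> - 1 \<and> [v + d ^ i = w] (mod N))} \<rparr>"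

lemma is_path_intro_upt:
  assumes "u \<le> v" "v < N" "d \<ge> 2"
  shows "is_path (rec_circulant N d) u [u..<Suc v] v"
proof -
  have "{[u..<Suc v] ! i, [u..<Suc v] ! Suc i} \<in> edges (rec_circulant N d)" if "i < v - u" for i
  proof -
    have "N \<ge> 2" using that assms by linarith
    then have "log (real d) (real N) > 0" using assms by simp
    then have "int 0 \<le> \<lceil>log (real d) (real N)\<rceil> - 1" by linarith
    moreover have "[u + i + d ^ 0 = u + Suc i] (mod N)" by simp
    ultimately have "{u + i, u + Suc i} \<in> edges (rec_circulant N d)"
      using that assms unfolding rec_circulant_def ugraph.simps mem_Collect_eq
      by (intro exI[of _ "u + i"] exI[of _ "u + Suc i"] conjI exI[of _ 0]) auto
    moreover have "[u..<Suc v] ! i = u + i" "[u..<Suc v] ! Suc i = u + Suc i"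
      using that assms by (simp_all add: nth_append del: upt_Suc)
    ultimately show ?thesis by simp
  qed
  then have "set (path_edges [u..<Suc v]) \<subseteq> edges (rec_circulant N d)"
    using assms by (auto simp: path_edges_def simp del: upt_Suc)
  then show ?thesis using assms
    by (auto simp: is_path_def rec_circulant_def hd_upt simp del: upt_Suc)
qed

lemma path_edges_rev: "path_edges (rev p) = rev (path_edges p)"
  unfolding path_edges_def
  by (rule nth_equalityI) (auto simp: rev_nth Suc_diff_Suc insert_commute)

lemma is_path_rev: "is_path G u p v \<Longrightarrow> is_path G v (rev p) u"
  by (auto simp: is_path_def path_edges_rev hd_rev last_rev)

lemma connected_rec_circulant:
  assumes "d \<ge> 2"
  shows "connected_graph (rec_circulant N d)"
  unfolding connected_graph_def
proof (intro ballI)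
  fix u v assume "u \<in> verts (rec_circulant N d)" "v \<in> verts (rec_circulant N d)"
  then have "u < N" "v < N" by (auto simp: rec_circulant_def)
  then show "\<exists>p. is_path (rec_circulant N d) u p v"
    using is_path_intro_upt[of u v N d] is_path_rev[OF is_path_intro_upt[of v u N d]] assms
    by (cases "u \<le> v") auto
qed

lemma simple_graph_rec_circulant:
  assumes "d \<ge> 2"
  shows "simple_graph (rec_circulant N d)"
proof -
  have "v \<noteq> w" if "v < N" "w < N" "int i \<le> \<lceil>log (real d) (real N)\<rceil> - 1"
    "[v + d ^ i = w] (mod N)" for v w i
  proof
    assume "v = w"
    with that have "[d ^ i = 0] (mod N)"
      by (metis add.right_neutral cong_add_lcancel_nat)
    then have "N dvd d ^ i" by (simp add: cong_0_iff)
    moreover have "d ^ i > 0" using assms by simp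
    ultimately have "N \<le> d ^ i" by (rule dvd_imp_le)
    moreover have "real i < log (real d) (real N)" using that(3) by linarith
    then have "real d powr real i < real N"
      using assms that(1) by (subst (asm) less_log_iff) auto
    then have "real (d ^ i) < real N" using assms by (simp add: powr_realpow)
    ultimately show False by linarith
  qed
  then show ?thesis
    unfolding simple_graph_def rec_circulant_def by (fastforce simp: card_insert_if)
qed

lemma distinct_path_edges:
  assumes "distinct p"
  shows "distinct (path_edges p)"
  unfolding path_edges_def distinct_map
proof (intro conjI inj_onI)
  fix i j assume "i \<in> set [0..<length p - 1]" "j \<in> set [0..<length p - 1]"
    and eq: "{p ! i, p ! Suc i} = {p ! j, p ! Suc j}"
  then have "Suc i < length p" "Suc j < length p" by auto
  with eq assms show "i = j"
    by (auto simp: doubleton_eq_iff nth_eq_iff_index_eq)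
qed simp

lemma strong_rainbow_connecting_exists:
  assumes "simple_graph G" "connected_graph G"
  shows "\<exists>k c. edge_coloring G k c \<and> strong_rainbow_connecting G c \<and> rainbow_connecting G c"
proof -
  have "edges G \<subseteq> Pow (verts G)" "finite (verts G)"
    using assms(1) by (auto simp: simple_graph_def)
  then have "finite (edges G)" by (meson finite_Pow_iff finite_subset)
  then obtain c :: "'a set \<Rightarrow> nat" where c: "inj_on c (edges G)" "c ` edges G = {0..<card (edges G)}"
    using ex_bij_betw_finite_nat unfolding bij_betw_def by blast
  let ?c = "Suc \<circ> c"
  have inj: "inj_on ?c (edges G)" using c(1) by (simp add: comp_inj_on)
  have rainbow: "rainbow_path ?c p" if "is_path G u p v" for u p v
    using that inj by (auto simp: is_path_def rainbow_path_def distinct_map distinct_path_edges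
        simp del: o_apply intro: inj_on_subset)
  have "strong_rainbow_connecting G ?c"
    unfolding strong_rainbow_connecting_def
  proof (intro ballI impI)
    fix u v assume "u \<in> verts G" "v \<in> verts G" "u \<noteq> v"
    then obtain q where "is_path G u q v" using assms(2) unfolding connected_graph_def by blast
    then have "\<exists>n p. is_path G u p v \<and> path_length p = n" by blast
    then have "\<exists>p. is_path G u p v \<and> path_length p = graph_dist G u v"
      unfolding graph_dist_def by (rule LeastI_ex)
    then show "\<exists>p. is_path G u p v \<and> rainbow_path ?c p \<and> path_length p = graph_dist G u v"
      using rainbow by blast
  qed
  moreover from this have "rainbow_connecting G ?c"
    unfolding strong_rainbow_connecting_def rainbow_connecting_def by blast
  moreover have "edge_coloring G (card (edges G)) ?c"
    unfolding edge_coloring_def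
  proof
    fix e assume "e \<in> edges G"
    then have "c e \<in> {0..<card (edges G)}" using c(2) by blast
    then show "?c e \<in> {1..card (edges G)}" by simp
  qed
  ultimately show ?thesis by blast
qed

end

theory Submission
  imports Defs
begin

text \<open>A walk from \<open>u\<close> to \<open>v\<close> in a recursive circulant spells out a signed expansion
  \<open>v - u \<equiv> (\<Sum>i. x\<^sub>i d\<^sup>i)\<close> modulo the order \<open>N\<close>, where \<open>x\<^sub>i\<close> counts the forward minus the
  backward steps along the generator \<open>d\<^sup>i\<close>; conversely an expansion can be walked, one
  generator after the other, in \<open>\<Sum>i. \<bar>x\<^sub>i\<bar>\<close> steps. So distances are the minimal costs
  \<open>\<Sum>i. \<bar>x\<^sub>i\<bar>\<close> of expansions (\<open>digits_of_walk\<close>, \<open>walk_of_digits\<close>), and everything rests on normal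
  forms of optimal expansions. Exchanging \<open>d\<close> at position \<open>i\<close> for \<open>1\<close> at position
  \<open>i + 1\<close> never raises the cost if \<open>\<bar>x\<^sub>i\<bar> > d/2\<close>, so an optimal expansion may be taken with all digits
  of absolute value at most \<open>\<lfloor>d/2\<rfloor>\<close>, and at most \<open>\<lfloor>n/2\<rfloor>\<close> at the top generator, whose cyclic
  order is \<open>n\<close> (\<open>optimal_bounded_digits\<close>). For \<open>d = 2\<close> it may be taken with digits in
  \<open>{-1, 0, 1}\<close>, no two neighbouring ones being nonzero (\<open>optimal_non_adjacent\<close>).

  Upper bounds. The edges of generator \<open>d\<^sup>i\<close> form cycles of length \<open>N / d\<^sup>i\<close>, and the edge from
  \<open>v\<close> to \<open>v + d\<^sup>i\<close> has position \<open>\<lfloor>v / d\<^sup>i\<rfloor>\<close> on its cycle. The path that walks a normal form is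
  rainbow as soon as, on each cycle, as many consecutive edges as the bound on the digit have
  distinct colors, and the generators it uses have disjoint palettes
  (\<open>src_le_of_generator_coloring\<close>). Coloring positions modulo \<open>K\<close> does this when \<open>K\<close> divides the
  cycle length and is no less than the bound on the digit; otherwise the
  positions are colored modulo \<open>h = \<lfloor>d/2\<rfloor>\<close> and the few left over at the end of the cycle get new colors. The case distinction of the theorem is the arithmetic of the
  cycle lengths \<open>r d\<^sup>k\<close> modulo \<open>h\<close>. For \<open>d = 2\<close> two neighbouring generators can share a color.

  Lower bounds. A rainbow path is no shorter than the distance of its ends, so the diameter bounds
  \<open>rc\<close> from below. For odd \<open>d\<close> the bounded digits of a residue are unique below the top, and the
  residue with all digits maximal has distance \<open>\<lfloor>d/2\<rfloor> m + \<lfloor>r/2\<rfloor>\<close> from 0, which is the upper bound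
  wherever equality is asserted; for \<open>d = 2\<close> the same argument in base 4 serves for the residue \<open>\<Sum>j. 4\<^sup>j\<close>.\<close>

section \<open>Walks and shortest paths\<close>

definition walk :: "'a ugraph \<Rightarrow> 'a \<Rightarrow> 'a list \<Rightarrow> 'a \<Rightarrow> bool" where
  "walk G u p v \<longleftrightarrow>
     p \<noteq> [] \<and> hd p = u \<and> last p = v \<and> set p \<subseteq> verts G \<and> set (path_edges p) \<subseteq> edges G"

lemma is_path_iff_walk: "is_path G u p v \<longleftrightarrow> walk G u p v \<and> distinct p"
  by (auto simp: is_path_def walk_def)

lemma path_edges_simps [simp]:
  "path_edges [] = []"
  "path_edges [x] = []"
  "path_edges (x # y # p) = {x, y} # path_edges (y # p)"
proof -
  have "[0..<Suc (length p)] = 0 # map Suc [0..<length p]"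
    by (simp add: map_Suc_upt upt_conv_Cons del: upt_Suc)
  then show "path_edges (x # y # p) = {x, y} # path_edges (y # p)"
    by (simp add: path_edges_def del: upt_Suc)
qed (simp_all add: path_edges_def)

lemma path_edges_append:
  "path_edges (p @ x # q) = path_edges (p @ [x]) @ path_edges (x # q)"
proof (induction p)
  case (Cons y p)
  then show ?case by (cases p) auto
qed simp

lemma path_length_eq: "path_length p = length p - 1"
  by (simp add: path_length_def path_edges_def)

lemma walk_append:
  assumes "walk G u p v" "walk G v q w"
  obtains s where "walk G u s w" "path_edges s = path_edges p @ path_edges q"
proof -
  obtain p' where p: "p = p' @ [v]"
    using assms(1) by (metis append_butlast_last_id walk_def)
  obtain q' where q: "q = v # q'"
    using assms(2) by (metis list.collapse walk_def)
  have "path_edges (p' @ q) = path_edges p @ path_edges q"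
    unfolding q p by (rule path_edges_append)
  moreover from this have "walk G u (p' @ q) w"
    using assms unfolding walk_def p q by (cases p') auto
  ultimately show thesis using that by blast
qed

lemma walk_rev: "walk G u p v \<Longrightarrow> walk G v (rev p) u"
  by (auto simp: walk_def path_edges_rev hd_rev last_rev)

text \<open>Cutting out the closed part between two visits to the same vertex. The strict inequality for
  walks with a repeated vertex shows that shortest walks are paths.\<close>

lemma walk_shorten:
  assumes "walk G u p v"
  shows "\<exists>q. is_path G u q v \<and> path_length q \<le> path_length p \<and>
             (\<not> distinct p \<longrightarrow> path_length q < path_length p)"
  using assms
proof (induction "length p" arbitrary: p rule: less_induct)
  case less
  show ?case
  proof (cases "distinct p")
    case True
    then show ?thesis using less.prems by (auto simp: is_path_iff_walk)
  next
    case False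
    then obtain xs ys zs y where p: "p = xs @ [y] @ ys @ [y] @ zs"
      using not_distinct_decomp by blast
    let ?p = "xs @ y # zs"
    have "path_edges p = path_edges (xs @ [y]) @ path_edges (y # ys @ [y]) @ path_edges (y # zs)"
      using path_edges_append[of xs y "ys @ y # zs"] path_edges_append[of "y # ys" y zs]
      by (simp add: p)
    moreover have "path_edges ?p = path_edges (xs @ [y]) @ path_edges (y # zs)"
      by (rule path_edges_append)
    ultimately have "set (path_edges ?p) \<subseteq> set (path_edges p)" by auto
    moreover have "hd ?p = hd p" by (cases xs) (simp_all add: p)
    ultimately have "walk G u ?p v"
      using less.prems unfolding walk_def by (auto simp: p)
    moreover have "length ?p < length p" by (simp add: p)
    ultimately obtain q where q: "is_path G u q v" "path_length q \<le> path_length ?p"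
      using less.hyps by blast
    moreover have "path_length ?p < path_length p" by (simp add: p path_length_eq)
    ultimately show ?thesis by (intro exI[of _ q]) linarith
  qed
qed

lemma graph_dist_le_walk: "walk G u p v \<Longrightarrow> graph_dist G u v \<le> path_length p"
proof -
  assume "walk G u p v"
  then obtain q where "is_path G u q v" "path_length q \<le> path_length p"
    using walk_shorten[of G u p v] by blast
  then have "graph_dist G u v \<le> path_length q"
    unfolding graph_dist_def by (intro Least_le exI[of _ q]) simp
  with \<open>path_length q \<le> path_length p\<close> show ?thesis by linarith
qed

lemma shortest_walk_is_path:
  assumes "walk G u p v" and "\<And>q. walk G u q v \<Longrightarrow> path_length p \<le> path_length q"
  shows "is_path G u p v" "path_length p = graph_dist G u v"
proof -
  show path: "is_path G u p v"
    using walk_shorten[OF assms(1)] assms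
    unfolding is_path_iff_walk by (metis leD)
  show "path_length p = graph_dist G u v"
    unfolding graph_dist_def
    by (rule Least_equality[symmetric]) (use path assms(2) in \<open>auto simp: is_path_iff_walk\<close>)
qed

section \<open>Rainbow connection numbers\<close>

lemma rc_le_src:
  assumes "simple_graph G" "connected_graph G"
  shows "rc G \<le> src G"
proof -
  have "\<exists>k c. edge_coloring G k c \<and> strong_rainbow_connecting G c"
    using strong_rainbow_connecting_exists[OF assms] by blast
  from LeastI_ex[OF this] obtain c
    where "edge_coloring G (src G) c" "strong_rainbow_connecting G c"
    unfolding src_def by blast
  then have "edge_coloring G (src G) c \<and> rainbow_connecting G c"
    unfolding strong_rainbow_connecting_def rainbow_connecting_def by blast
  then show ?thesis unfolding rc_def by (intro Least_le exI[of _ c])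
qed

lemma src_le:
  "edge_coloring G k c \<Longrightarrow> strong_rainbow_connecting G c \<Longrightarrow> src G \<le> k"
  unfolding src_def by (intro Least_le exI[of _ c]) blast

text \<open>The colors of a rainbow path are distinct, so their number is the length of the path.\<close>

lemma le_rc:
  assumes "simple_graph G" "connected_graph G"
    and "u \<in> verts G" "v \<in> verts G" "u \<noteq> v"
    and "\<And>p. is_path G u p v \<Longrightarrow> k \<le> path_length p"
  shows "k \<le> rc G"
proof -
  have "\<exists>k c. edge_coloring G k c \<and> rainbow_connecting G c"
    using strong_rainbow_connecting_exists[OF assms(1,2)] by blast
  from LeastI_ex[OF this] obtain c
    where c: "edge_coloring G (rc G) c" "rainbow_connecting G c"
    unfolding rc_def by blast
  then obtain p where p: "is_path G u p v" "rainbow_path c p"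
    using assms(3-5) unfolding rainbow_connecting_def by blast
  have "k \<le> path_length p" using assms(6) p(1) .
  also have "\<dots> = card (set (map c (path_edges p)))"
    using distinct_card[OF p(2)[unfolded rainbow_path_def]] by (simp add: path_length_def)
  also have "\<dots> \<le> card {1..rc G}"
    using c(1) p(1) unfolding edge_coloring_def is_path_def by (intro card_mono) auto
  finally show ?thesis by simp
qed

section \<open>Signed digit expansions\<close>

definition digit_value :: "nat \<Rightarrow> nat \<Rightarrow> (nat \<Rightarrow> int) \<Rightarrow> int" where
  "digit_value d k x = (\<Sum>i<k. x i * int d ^ i)"

definition digit_cost :: "nat \<Rightarrow> (nat \<Rightarrow> int) \<Rightarrow> nat" where
  "digit_cost k x = (\<Sum>i<k. nat \<bar>x i\<bar>)"

lemma digit_value_upd: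
  assumes "i < k"
  shows "digit_value d k (x(i := e)) = digit_value d k x + (e - x i) * int d ^ i"
proof -
  have eq: "digit_value d k y = y i * int d ^ i + (\<Sum>j\<in>{..<k} - {i}. y j * int d ^ j)" for y
    using assms unfolding digit_value_def by (subst sum.remove[of _ i]) auto
  have "(\<Sum>j\<in>{..<k} - {i}. (x(i := e)) j * int d ^ j) = (\<Sum>j\<in>{..<k} - {i}. x j * int d ^ j)"
    by (intro sum.cong) auto
  then show ?thesis by (simp add: eq[of x] eq[of "x(i := e)"] algebra_simps)
qed

lemma digit_cost_upd:
  assumes "i < k"
  shows "int (digit_cost k (x(i := e))) = int (digit_cost k x) + \<bar>e\<bar> - \<bar>x i\<bar>"
proof -
  have eq: "digit_cost k y = nat \<bar>y i\<bar> + (\<Sum>j\<in>{..<k} - {i}. nat \<bar>y j\<bar>)" for y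
    using assms unfolding digit_cost_def by (subst sum.remove[of _ i]) auto
  have "(\<Sum>j\<in>{..<k} - {i}. nat \<bar>(x(i := e)) j\<bar>) = (\<Sum>j\<in>{..<k} - {i}. nat \<bar>x j\<bar>)"
    by (intro sum.cong) auto
  then show ?thesis by (simp add: eq[of x] eq[of "x(i := e)"])
qed

text \<open>Uniqueness of digits: the lowest digit is divisible by \<open>d\<close>, hence zero, and dividing by \<open>d\<close>
  leaves the same situation with one digit less.\<close>

lemma digits_zero_of_dvd:
  assumes "\<And>i. i < k \<Longrightarrow> \<bar>z i\<bar> < int d" and "int d ^ k dvd (\<Sum>i<k. z i * int d ^ i)"
    and "i < k"
  shows "z i = 0"
  using assms
proof (induction k arbitrary: z i)
  case (Suc k)
  have split: "(\<Sum>i<Suc k. z i * int d ^ i) = z 0 + int d * (\<Sum>i<k. z (Suc i) * int d ^ i)"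
    by (simp add: sum.lessThan_Suc_shift sum_distrib_left algebra_simps del: sum.lessThan_Suc)
  have "int d dvd (\<Sum>i<Suc k. z i * int d ^ i)"
    using Suc.prems(2) by (meson dvd_power dvd_trans zero_less_Suc)
  then have "int d dvd z 0"
    unfolding split by (simp add: dvd_add_left_iff)
  then have z0: "z 0 = 0"
    using Suc.prems(1)[of 0] zdvd_imp_le by (metis abs_of_nonneg dvd_abs_iff linorder_not_le zero_less_Suc zero_less_abs_iff)
  have "int d \<noteq> 0" using Suc.prems(1)[of 0] by auto
  then have "int d ^ k dvd (\<Sum>i<k. z (Suc i) * int d ^ i)"
    using Suc.prems(2) unfolding split z0 by simp
  then have "z (Suc j) = 0" if "j < k" for j
    using Suc.IH[of "z \<circ> Suc" j] Suc.prems(1) that by simp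
  then show ?case using z0 Suc.prems(3) by (cases i) auto
qed simp

text \<open>The graph \<open>G(r d\<^sup>m, d)\<close> has the generators \<open>d\<^sup>0, \<dots>, d\<^sup>m\<close> if \<open>r \<ge> 2\<close>, but
  only \<open>d\<^sup>0, \<dots>, d\<^sup>m\<^sup>-\<^sup>1\<close> if \<open>r = 1\<close>. Writing its order as \<open>n d\<^sup>l\<close> with \<open>2 \<le> n \<le> d\<close>
  treats both cases alike: \<open>d\<^sup>l\<close> is the last generator and \<open>n\<close> the length of its cycles. The two cases
  are \<open>n = r\<close>, \<open>l = m\<close> and \<open>n = d\<close>, \<open>l = m - 1\<close>.\<close>

locale circulant_digits =
  fixes d n l :: nat
  assumes base: "d \<ge> 2" and top_order: "2 \<le> n" "n \<le> d"
begin

abbreviation (input) order :: nat where "order \<equiv> n * d ^ l"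

abbreviation (input) graph :: "nat ugraph" where "graph \<equiv> rec_circulant (n * d ^ l) d"

definition represents :: "(nat \<Rightarrow> int) \<Rightarrow> int \<Rightarrow> bool" where
  "represents x a \<longleftrightarrow> [digit_value d (Suc l) x = a] (mod int order)"

definition optimal :: "(nat \<Rightarrow> int) \<Rightarrow> int \<Rightarrow> bool" where
  "optimal x a \<longleftrightarrow>
     represents x a \<and> (\<forall>y. represents y a \<longrightarrow> digit_cost (Suc l) x \<le> digit_cost (Suc l) y)"

lemma represents_upd:
  assumes "represents x a" "i \<le> l"
  shows "represents (x(i := x i + e)) (a + e * int d ^ i)"
  using assms unfolding represents_def by (simp add: digit_value_upd cong_add del: of_nat_mult)

lemma represents_carry:
  assumes "represents x a" "i < l"
  shows "represents (x(i := x i - e * int d, Suc i := x (Suc i) + e)) a"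
  using assms unfolding represents_def by (simp add: digit_value_upd algebra_simps)

lemma digit_cost_carry:
  assumes "i < l"
  shows "int (digit_cost (Suc l) (x(i := x i - e * int d, Suc i := x (Suc i) + e))) =
    int (digit_cost (Suc l) x) + \<bar>x i - e * int d\<bar> - \<bar>x i\<bar> + \<bar>x (Suc i) + e\<bar> - \<bar>x (Suc i)\<bar>"
  using assms by (simp add: digit_cost_upd)

text \<open>The top digit only matters modulo \<open>n\<close>: there is no position to carry to.\<close>

lemma represents_wrap:
  assumes "represents x a"
  shows "represents (x(l := x l - e * int n)) a"
proof -
  have "digit_value d (Suc l) (x(l := x l - e * int n)) = digit_value d (Suc l) x - e * int order"
    by (simp add: digit_value_upd algebra_simps)
  then have "[digit_value d (Suc l) (x(l := x l - e * int n)) = digit_value d (Suc l) x] (mod int order)"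
    by (simp only: cong_iff_dvd_diff) simp
  then show ?thesis using assms unfolding represents_def by (rule cong_trans)
qed

lemma optimal_exists: "\<exists>x. optimal x a"
proof -
  have "represents ((\<lambda>_. 0)(0 := a)) a"
    unfolding represents_def by (subst digit_value_upd) (simp_all add: digit_value_def)
  from ex_has_least_nat[of "\<lambda>x. represents x a", OF this, of "digit_cost (Suc l)"]
  show ?thesis unfolding optimal_def by blast
qed

lemma optimal_replace:
  assumes "optimal x a" "represents y a" "digit_cost (Suc l) y \<le> digit_cost (Suc l) x"
  shows "optimal y a"
  using assms unfolding optimal_def by (meson order_trans)

lemma optimal_top_bound:
  assumes "optimal x a"
  shows "2 * \<bar>x l\<bar> \<le> int n"
proof (rule ccontr)
  assume big: "\<not> 2 * \<bar>x l\<bar> \<le> int n"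
  define e :: int where "e = sgn (x l)"
  have "represents (x(l := x l - e * int n)) a"
    using assms represents_wrap by (simp add: optimal_def)
  then have "digit_cost (Suc l) x \<le> digit_cost (Suc l) (x(l := x l - e * int n))"
    using assms by (simp add: optimal_def)
  then have "\<bar>x l\<bar> \<le> \<bar>x l - e * int n\<bar>"
    using digit_cost_upd[of l "Suc l" x "x l - e * int n"] by linarith
  then show False using big top_order unfolding e_def by (auto simp: sgn_if split: if_splits)
qed

text \<open>For a larger digit, subtracting \<open>\<plusminus>d\<close> would save more than the cost of carrying \<open>\<plusminus>1\<close>.\<close>

lemma optimal_digit_bound:
  assumes "optimal x a" "i < l"
  shows "2 * \<bar>x i\<bar> \<le> int d + 1"
proof (rule ccontr)
  assume big: "\<not> 2 * \<bar>x i\<bar> \<le> int d + 1"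
  define e :: int where "e = sgn (x i)"
  let ?y = "x(i := x i - e * int d, Suc i := x (Suc i) + e)"
  have "represents ?y a"
    using assms represents_carry by (simp add: optimal_def)
  then have "digit_cost (Suc l) x \<le> digit_cost (Suc l) ?y"
    using assms by (simp add: optimal_def)
  then have "\<bar>x i\<bar> + \<bar>x (Suc i)\<bar> \<le> \<bar>x i - e * int d\<bar> + \<bar>x (Suc i) + e\<bar>"
    using digit_cost_carry[OF assms(2), of x e] by linarith
  then show False using big base unfolding e_def by (auto simp: sgn_if split: if_splits)
qed

text \<open>The only digits that optimality leaves too large are those with \<open>2 \<bar>x\<^sub>i\<bar> = d + 1\<close>. A carry turns
  such a digit into one with \<open>2 \<bar>x\<^sub>i\<bar> = d - 1\<close> at equal cost; performing these carries from the
  lowest position upwards does not disturb the digits already treated.\<close>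

lemma optimal_bounded_digits:
  "\<exists>x. optimal x a \<and> (\<forall>i<l. \<bar>x i\<bar> \<le> int (d div 2)) \<and> \<bar>x l\<bar> \<le> int (n div 2)"
proof -
  have "\<exists>x. optimal x a \<and> (\<forall>i<k. \<bar>x i\<bar> \<le> int (d div 2))" if "k \<le> l" for k
    using that
  proof (induction k)
    case 0
    then show ?case using optimal_exists by simp
  next
    case (Suc k)
    then obtain x where x: "optimal x a" "\<forall>i<k. \<bar>x i\<bar> \<le> int (d div 2)" by auto
    show ?case
    proof (cases "\<bar>x k\<bar> \<le> int (d div 2)")
      case True
      then show ?thesis using x by (auto simp: less_Suc_eq)
    next
      case False
      define e :: int where "e = sgn (x k)"
      let ?y = "x(k := x k - e * int d, Suc k := x (Suc k) + e)"
      have k: "2 * \<bar>x k\<bar> = int d + 1"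
        using False optimal_digit_bound[OF x(1), of k] Suc.prems by linarith
      then have low: "\<bar>x k - e * int d\<bar> = int d - \<bar>x k\<bar>" "\<bar>e\<bar> = 1"
        using base unfolding e_def by (auto simp: sgn_if split: if_splits)
      have "represents ?y a"
        using x(1) Suc.prems represents_carry by (simp add: optimal_def)
      moreover have "digit_cost (Suc l) ?y \<le> digit_cost (Suc l) x"
        using digit_cost_carry[of k x e] Suc.prems k low by linarith
      ultimately have "optimal ?y a" by (rule optimal_replace[OF x(1)])
      moreover have "\<forall>i<Suc k. \<bar>?y i\<bar> \<le> int (d div 2)"
        using x(2) k low by (auto simp: less_Suc_eq)
      ultimately show ?thesis by blast
    qed
  qed
  then obtain x where x: "optimal x a" "\<forall>i<l. \<bar>x i\<bar> \<le> int (d div 2)" by blast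
  moreover have "\<bar>x l\<bar> \<le> int (n div 2)" using optimal_top_bound[OF x(1)] by simp
  ultimately show ?thesis by blast
qed

text \<open>Optimality bounds all digits by 1 and excludes neighbours of opposite sign, because
  \<open>1 - 2 = -1\<close>. Equal neighbours \<open>1 + 2\<close> are replaced by \<open>-1 + 4\<close>, which costs no more, or even
  less when 4 vanishes at the top. As \<open>x\<^sub>k \<noteq> 0\<close> forces \<open>x\<^sub>k\<^sub>-\<^sub>1 = 0\<close>, the positions below are not
  affected.\<close>

lemma optimal_non_adjacent:
  assumes "d = 2"
  shows "\<exists>x. optimal x a \<and> (\<forall>i\<le>l. \<bar>x i\<bar> \<le> 1) \<and> (\<forall>i<l. x i = 0 \<or> x (Suc i) = 0)"
proof -
  have n: "n = 2" using assms top_order by simp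
  have small: "\<bar>x i\<bar> \<le> 1" if "optimal x a" "i \<le> l" for x i
    using optimal_digit_bound[OF that(1), of i] optimal_top_bound[OF that(1)] that(2) assms n
    by (cases "i = l") auto
  have "\<exists>x. optimal x a \<and> (\<forall>i<k. x i = 0 \<or> x (Suc i) = 0)" if "k \<le> l" for k
    using that
  proof (induction k)
    case 0
    then show ?case using optimal_exists by simp
  next
    case (Suc k)
    then obtain x where x: "optimal x a" "\<forall>i<k. x i = 0 \<or> x (Suc i) = 0" by auto
    show ?case
    proof (cases "x k = 0 \<or> x (Suc k) = 0")
      case True
      then show ?thesis using x by (auto simp: less_Suc_eq)
    next
      case False
      define e where "e = x k"
      have e: "e = 1 \<or> e = -1"
        using False small[OF x(1), of k] Suc.prems unfolding e_def by auto
      let ?y = "x(k := x k - e * int d, Suc k := x (Suc k) + e)"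
      have rep: "represents ?y a"
        using x(1) Suc.prems represents_carry by (simp add: optimal_def)
      then have "digit_cost (Suc l) x \<le> digit_cost (Suc l) ?y"
        using x(1) by (simp add: optimal_def)
      then have "\<bar>x (Suc k)\<bar> \<le> \<bar>x (Suc k) + e\<bar>"
        using digit_cost_carry[of k x e] Suc.prems e assms unfolding e_def by auto
      then have same: "x (Suc k) = e"
        using e False small[OF x(1), of "Suc k"] Suc.prems by auto
      show ?thesis
      proof (cases "Suc k = l")
        case True
        have "represents (?y(l := ?y l - e * int n)) a"
          using rep by (rule represents_wrap)
        then have "digit_cost (Suc l) x \<le> digit_cost (Suc l) (?y(l := ?y l - e * int n))"
          using x(1) by (simp add: optimal_def)
        moreover have "int (digit_cost (Suc l) (?y(l := ?y l - e * int n))) =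
            int (digit_cost (Suc l) ?y) + \<bar>?y l - e * int n\<bar> - \<bar>?y l\<bar>"
          by (rule digit_cost_upd) simp
        moreover have "?y l = 2 * e" using True same by auto
        ultimately show ?thesis
          using digit_cost_carry[of k x e] Suc.prems e same assms n e_def by auto
      next
        case neq: False
        let ?z = "?y(Suc k := ?y (Suc k) - e * int d, Suc (Suc k) := ?y (Suc (Suc k)) + e)"
        have "represents ?z a"
          using rep by (rule represents_carry) (use Suc.prems neq in simp)
        moreover have "digit_cost (Suc l) ?z \<le> digit_cost (Suc l) x"
          using digit_cost_carry[of k x e] digit_cost_carry[of "Suc k" ?y e] Suc.prems e same neq
          by (auto simp: assms e_def)
        ultimately have "optimal ?z a" by (rule optimal_replace[OF x(1)])
        moreover have "\<forall>i<Suc k. ?z i = 0 \<or> ?z (Suc i) = 0"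
          using x(2) False same assms by (auto simp: less_Suc_eq)
        ultimately show ?thesis by blast
      qed
    qed
  qed
  then show ?thesis using small by blast
qed

text \<open>The residue with all digits maximal. A bounded expansion of it differs from the maximal one by
  digits in \<open>{-(d - 1), \<dots>, 0}\<close> because \<open>d\<close> is odd, so both agree below the top; at the top
  the digit can at most change its sign, which leaves the cost unchanged.\<close>

lemma expensive_residue:
  assumes "odd d"
  shows "\<exists>a. \<forall>x. represents x a \<longrightarrow> (d div 2) * l + n div 2 \<le> digit_cost (Suc l) x"
proof -
  define h where "h = int (d div 2)"
  define t where "t = int (n div 2)"
  define a where "a = (\<Sum>i<l. h * int d ^ i) + t * int d ^ l"
  have "(d div 2) * l + n div 2 = digit_cost (Suc l) x"
    if x: "represents x a" "\<forall>i<l. \<bar>x i\<bar> \<le> h" "\<bar>x l\<bar> \<le> t" for x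
  proof -
    have diff: "digit_value d (Suc l) x - a =
        (\<Sum>i<l. (x i - h) * int d ^ i) + (x l - t) * int d ^ l"
      by (simp add: digit_value_def a_def sum_subtractf algebra_simps)
    have "int order dvd digit_value d (Suc l) x - a"
      using x(1) by (simp add: represents_def cong_iff_dvd_diff)
    then have dvd: "int n * int d ^ l dvd (\<Sum>i<l. (x i - h) * int d ^ i) + (x l - t) * int d ^ l"
      unfolding diff by simp
    then have "int d ^ l dvd (\<Sum>i<l. (x i - h) * int d ^ i) + (x l - t) * int d ^ l"
      by (rule dvd_mult_right)
    then have low_dvd: "int d ^ l dvd (\<Sum>i<l. (x i - h) * int d ^ i)"
      by (simp add: dvd_add_left_iff)
    have "\<bar>x i - h\<bar> < int d" if "i < l" for i
    proof -
      have "\<bar>x i\<bar> \<le> h" "2 * h < int d"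
        using x(2) that assms unfolding h_def by (auto elim!: oddE)
      then show ?thesis by linarith
    qed
    then have low: "x i = h" if "i < l" for i
      using digits_zero_of_dvd[OF _ low_dvd that] by simp
    then have "int n * int d ^ l dvd (x l - t) * int d ^ l"
      using dvd by simp
    then have "int n dvd x l - t" using base by simp
    then obtain q where q: "x l - t = int n * q" ..
    have "2 * t \<le> int n" "t \<ge> 0" "n > 0" unfolding t_def using top_order by auto
    \<comment> \<open>Both \<open>x l\<close> and \<open>t\<close> have absolute value at most \<open>n / 2\<close>; \<open>q = -1\<close> means \<open>x l = - t\<close>, \<open>n = 2 t\<close>.\<close>
    have "q = 0 \<or> q = -1"
    proof (rule ccontr)
      assume "\<not> (q = 0 \<or> q = -1)"
      then consider "q \<ge> 1" | "q \<le> -2" by linarith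
      then show False
      proof cases
        case 1
        then have "int n * 1 \<le> int n * q" by (intro mult_left_mono) auto
        then show False using q x(3) \<open>n > 0\<close> by linarith
      next
        case 2
        then have "int n * q \<le> int n * (-2)" by (intro mult_left_mono) auto
        then show False using q x(3) \<open>2 * t \<le> int n\<close> \<open>n > 0\<close> by linarith
      qed
    qed
    then have "\<bar>x l\<bar> = t"
      using q x(3) \<open>2 * t \<le> int n\<close> \<open>t \<ge> 0\<close> by auto
    then show ?thesis
      unfolding digit_cost_def using low by (simp add: h_def t_def)
  qed
  then have "(d div 2) * l + n div 2 \<le> digit_cost (Suc l) y" if "represents y a" for y
    using optimal_bounded_digits[of a] that unfolding optimal_def h_def t_def by metis
  then show ?thesis by blast
qed

text \<open>Two neighbouring binary digits of a non-adjacent expansion make up one digit in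
  \<open>{-2, \<dots>, 2}\<close> in base 4. This is close enough to the digits 1 of the residue
  \<open>\<Sum>j. 4\<^sup>j\<close> for uniqueness modulo powers of 4, so each pair costs at least 1. If the number of binary
  digits is odd, the top one is left over, and it vanishes modulo \<open>4\<^sup>k\<close>.\<close>

lemma expensive_residue_binary:
  assumes "d = 2"
  shows "\<exists>a. \<forall>x. represents x a \<longrightarrow> Suc l div 2 \<le> digit_cost (Suc l) x"
proof -
  define k where "k = Suc l div 2"
  define a :: int where "a = (\<Sum>j<k. 4 ^ j)"
  have n: "n = 2" using assms top_order by simp
  have pairs: "(\<Sum>i<2*j. f i) = (\<Sum>i<j. f (2*i) + f (Suc (2*i)))" for f :: "nat \<Rightarrow> 'b::comm_monoid_add" and j
    by (induction j) (simp_all add: algebra_simps)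
  have p4: "(2::int) ^ (2 * j) = 4 ^ j" for j by (simp add: power_mult)
  have sparse: "k \<le> digit_cost (Suc l) x"
    if x: "represents x a" "\<forall>i\<le>l. \<bar>x i\<bar> \<le> 1" "\<forall>i<l. x i = 0 \<or> x (Suc i) = 0" for x
  proof -
    define z where "z j = x (2 * j) + 2 * x (Suc (2 * j)) - 1" for j
    have sub: "{..<2*k} \<subseteq> {..<Suc l}" unfolding k_def by auto
    have pair_value: "digit_value 2 (2*k) x - a = (\<Sum>j<k. z j * int 4 ^ j)"
    proof -
      have "x (2*j) * int 2 ^ (2*j) + x (Suc (2*j)) * int 2 ^ Suc (2*j) - 4 ^ j = z j * int 4 ^ j" for j
        unfolding z_def of_nat_numeral power_Suc p4 by (simp only: algebra_simps)
      then show ?thesis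
        unfolding digit_value_def a_def pairs sum_subtractf[symmetric] by (simp only:)
    qed
    have "4 ^ k dvd digit_value 2 (Suc l) x - digit_value 2 (2*k) x"
    proof -
      have "digit_value 2 (Suc l) x - digit_value 2 (2*k) x = (\<Sum>i\<in>{..<Suc l} - {..<2*k}. x i * 2 ^ i)"
        unfolding digit_value_def by (subst sum_diff) (use sub in auto)
      moreover have "(4::int) ^ k dvd x i * 2 ^ i" if "i \<in> {..<Suc l} - {..<2*k}" for i
        using that unfolding p4[symmetric] by (intro dvd_mult le_imp_power_dvd) auto
      ultimately show ?thesis by (simp only: dvd_sum)
    qed
    moreover have "4 ^ k dvd digit_value 2 (Suc l) x - a"
    proof -
      have "(2::int) ^ (2*k) dvd 2 ^ Suc l" unfolding k_def by (intro le_imp_power_dvd) auto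
      then have "(4::int) ^ k dvd int order" unfolding p4 using n assms by simp
      moreover have "int order dvd digit_value 2 (Suc l) x - a"
        using x(1) unfolding represents_def cong_iff_dvd_diff by (simp only: assms)
      ultimately show ?thesis by (rule dvd_trans)
    qed
    ultimately have "4 ^ k dvd (digit_value 2 (Suc l) x - a) -
        (digit_value 2 (Suc l) x - digit_value 2 (2*k) x)"
      by (rule dvd_diff[rotated])
    then have "4 ^ k dvd digit_value 2 (2*k) x - a" by simp
    then have dvd: "int 4 ^ k dvd (\<Sum>j<k. z j * int 4 ^ j)" unfolding pair_value by simp
    have "\<bar>z j\<bar> < int 4" if "j < k" for j
    proof -
      have "Suc (2 * j) \<le> l" using that unfolding k_def by auto
      then show ?thesis using x(2)[rule_format, of "2*j"] x(2)[rule_format, of "Suc (2*j)"]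
          x(3)[rule_format, of "2*j"] unfolding z_def by auto
    qed
    then have "z j = 0" if "j < k" for j
      by (rule digits_zero_of_dvd[OF _ dvd that])
    then have "1 \<le> nat \<bar>x (2*j)\<bar> + nat \<bar>x (Suc (2*j))\<bar>" if "j < k" for j
      using that unfolding z_def by force
    then have "(\<Sum>j<k. 1) \<le> (\<Sum>j<k. nat \<bar>x (2*j)\<bar> + nat \<bar>x (Suc (2*j))\<bar>)"
      by (intro sum_mono) auto
    also have "\<dots> = (\<Sum>i<2*k. nat \<bar>x i\<bar>)" by (simp only: pairs)
    also have "\<dots> \<le> digit_cost (Suc l) x"
      unfolding digit_cost_def by (intro sum_mono2) (use sub in auto)
    finally show ?thesis by simp
  qed
  then have "Suc l div 2 \<le> digit_cost (Suc l) y" if "represents y a" for y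
  proof -
    obtain x where x: "optimal x a" "\<forall>i\<le>l. \<bar>x i\<bar> \<le> 1" "\<forall>i<l. x i = 0 \<or> x (Suc i) = 0"
      using optimal_non_adjacent[OF assms] by blast
    then have "k \<le> digit_cost (Suc l) x"
      by (intro sparse) (simp_all add: optimal_def)
    also have "\<dots> \<le> digit_cost (Suc l) y" using x(1) that by (simp add: optimal_def)
    finally show ?thesis by (simp add: k_def)
  qed
  then show ?thesis by blast
qed

section \<open>Walks in recursive circulants\<close>

lemma order_pos: "order > 0"
  using base top_order by simp

lemma generator_iff: "int i \<le> \<lceil>log (real d) (real order)\<rceil> - 1 \<longleftrightarrow> i \<le> l"
proof -
  have "int i \<le> \<lceil>log (real d) (real order)\<rceil> - 1 \<longleftrightarrow> real i < log (real d) (real order)"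
    by linarith
  also have "\<dots> \<longleftrightarrow> real d powr real i < real order"
    using base order_pos by (subst less_log_iff) (simp_all del: of_nat_mult of_nat_power)
  also have "\<dots> \<longleftrightarrow> d ^ i < order"
    using base by (simp add: powr_realpow flip: of_nat_power of_nat_mult)
  also have "\<dots> \<longleftrightarrow> i \<le> l"
  proof
    assume less: "d ^ i < order"
    show "i \<le> l"
    proof (rule ccontr)
      assume "\<not> i \<le> l"
      then have "d ^ Suc l \<le> d ^ i" using base by (intro power_increasing) auto
      moreover have "order \<le> d ^ Suc l" using top_order by simp
      ultimately show False using less by linarith
    qed
  next
    assume "i \<le> l"
    then have "d ^ i \<le> d ^ l" using base by (intro power_increasing) auto
    moreover have "2 * d ^ l \<le> order" using top_order by (intro mult_right_mono) auto
    moreover have "d ^ l > 0" using base by simp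
    ultimately show "d ^ i < order" by linarith
  qed
  finally show ?thesis .
qed

lemma verts_graph: "verts graph = {..<order}"
  by (auto simp: rec_circulant_def)

lemma edges_graph: "edges graph = {{v, (v + d ^ i) mod order} | v i. v < order \<and> i \<le> l}"
proof -
  have "w < order \<and> [v + d ^ i = w] (mod order) \<longleftrightarrow> w = (v + d ^ i) mod order" for v w i
    using order_pos unfolding cong_def by (metis mod_less mod_less_divisor)
  then have "edges graph = {{v, w} | v w. v < order \<and> (\<exists>i\<le>l. w = (v + d ^ i) mod order)}"
    unfolding rec_circulant_def ugraph.simps generator_iff by blast
  then show ?thesis by blast
qed

lemma generator_edge:
  assumes "v < order" "i \<le> l"
  shows "{v, (v + d ^ i) mod order} \<in> edges graph"
  using assms edges_graph by blast

text \<open>Each step of the walk changes one digit by \<open>\<plusminus>1\<close>.\<close>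

lemma digits_of_walk:
  assumes "walk graph u p v"
  shows "\<exists>x. represents x (int v - int u) \<and> digit_cost (Suc l) x \<le> path_length p"
  using assms
proof (induction p arbitrary: u)
  case Nil
  then show ?case by (simp add: walk_def)
next
  case (Cons u' q)
  then have u: "u' = u" by (simp add: walk_def)
  show ?case
  proof (cases q)
    case Nil
    then have "v = u" using Cons.prems by (simp add: walk_def)
    then have "represents (\<lambda>_. 0) (int v - int u)"
      by (simp add: represents_def digit_value_def)
    moreover have "digit_cost (Suc l) (\<lambda>_. 0) = 0" by (simp add: digit_cost_def)
    ultimately show ?thesis by (metis le0)
  next
    case (Cons w q')
    then have edge: "{u, w} \<in> edges graph" and "walk graph w q v"
      using \<open>walk graph u (u' # q) v\<close> u by (auto simp: walk_def)
    from Cons.IH[OF this(2)] obtain x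
      where x: "represents x (int v - int w)" "digit_cost (Suc l) x \<le> path_length q" by blast
    from edge obtain a i where i: "i \<le> l" and e: "{u, w} = {a, (a + d ^ i) mod order}"
      unfolding edges_graph by blast
    have "\<exists>s::int. \<bar>s\<bar> = 1 \<and> [int w - int u = s * int d ^ i] (mod int order)"
    proof -
      have c: "[int ((a + d ^ i) mod order) - int a = 1 * int d ^ i] (mod int order)"
        by (simp add: cong_def of_nat_mod mod_diff_left_eq del: of_nat_mult)
      consider "u = a" "w = (a + d ^ i) mod order" | "w = a" "u = (a + d ^ i) mod order"
        using e by (auto simp: doubleton_eq_iff)
      then show ?thesis
      proof cases
        case 1
        then show ?thesis using c by (intro exI[of _ 1]) simp
      next
        case 2
        then have "[- (int u - int w) = - (1 * int d ^ i)] (mod int order)"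
          using c by (simp only: cong_minus_minus_iff)
        then show ?thesis by (intro exI[of _ "-1"]) simp
      qed
    qed
    then obtain s :: int where s: "\<bar>s\<bar> = 1" "[int w - int u = s * int d ^ i] (mod int order)" by blast
    let ?y = "x(i := x i + s)"
    have "represents ?y (int v - int w + s * int d ^ i)"
      using x(1) i by (rule represents_upd)
    moreover have "[int v - int w + s * int d ^ i = int v - int w + (int w - int u)] (mod int order)"
      using s(2) by (intro cong_add cong_refl) (rule cong_sym)
    ultimately have "represents ?y (int v - int u)"
      unfolding represents_def by (auto intro: cong_trans)
    moreover have "digit_cost (Suc l) ?y \<le> path_length (u' # q)"
      using x(2) digit_cost_upd[of i "Suc l" x "x i + s"] i s(1) Cons by (simp add: path_length_eq)
    ultimately show ?thesis by blast
  qed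
qed

lemma le_rc_of_expensive_residue:
  assumes "\<And>x. represents x a \<Longrightarrow> k \<le> digit_cost (Suc l) x"
  shows "k \<le> rc graph"
proof (cases "k = 0")
  case False
  define v where "v = nat (a mod int order)"
  have N: "0 < int order" using order_pos by linarith
  then have v: "v < order" "int v = a mod int order"
    unfolding v_def using pos_mod_bound[OF N, of a] pos_mod_sign[OF N, of a] by linarith+
  have rep: "represents x a" if "represents x (int v - int 0)" for x
    using that unfolding represents_def v(2) by (simp add: cong_def del: of_nat_mult)
  have "v \<noteq> 0"
  proof
    assume "v = 0"
    then have "represents (\<lambda>_. 0) a"
      by (intro rep) (simp add: represents_def digit_value_def)
    then show False using assms False by (fastforce simp: digit_cost_def)
  qed
  show ?thesis
  proof (rule le_rc[OF simple_graph_rec_circulant[OF base] connected_rec_circulant[OF base]])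
    show "k \<le> path_length p" if "is_path graph 0 p v" for p
      using digits_of_walk[of 0 p v] that rep assms unfolding is_path_iff_walk
      by (meson order_trans)
  qed (use v \<open>v \<noteq> 0\<close> order_pos in \<open>auto simp: verts_graph\<close>)
qed simp

section \<open>Colorings by position on generator cycles\<close>

text \<open>An edge determines its generator, and also its starting point unless the generator is an
  involution. Hence a coloring may be prescribed in terms of generator and starting point, provided
  that it is constant on involutions.\<close>

lemma generator_unique:
  assumes "v < order" "w < order" "i \<le> l" "j \<le> l"
    and eq: "{v, (v + d ^ i) mod order} = {w, (w + d ^ j) mod order}"
  shows "i = j \<and> (v = w \<or> 2 * d ^ i = order)"
proof -
  have le: "d ^ k \<le> d ^ l" if "k \<le> l" for k
    using that base by (intro power_increasing) auto
  have N: "2 * d ^ l \<le> order" using top_order by (intro mult_right_mono) auto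
  have pos: "d ^ k > 0" for k using base by simp
  consider "v = w" "(v + d ^ i) mod order = (v + d ^ j) mod order"
    | "v = (w + d ^ j) mod order" "w = (v + d ^ i) mod order"
    using eq by (auto simp: doubleton_eq_iff)
  then show ?thesis
  proof cases
    case 1
    then have "[d ^ i = d ^ j] (mod order)"
      unfolding cong_def[symmetric] by (simp add: cong_add_lcancel_nat)
    moreover have "d ^ i < order" "d ^ j < order"
      using le[OF assms(3)] le[OF assms(4)] N pos[of l] by linarith+
    ultimately have "d ^ i = d ^ j" by (metis cong_def mod_less)
    then show ?thesis using base 1(1) by simp
  next
    case 2
    have "[v + (d ^ i + d ^ j) = w + d ^ j] (mod order)"
      using 2(2) by (simp add: cong_def mod_add_left_eq add.assoc[symmetric])
    also have "[w + d ^ j = v + 0] (mod order)" using 2(1) by (simp add: cong_def)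
    finally have "[d ^ i + d ^ j = 0] (mod order)" by (simp only: cong_add_lcancel_nat)
    then have "order dvd d ^ i + d ^ j" by (simp only: cong_0_iff)
    then have "order \<le> d ^ i + d ^ j" using pos by (intro dvd_imp_le) auto
    then have "d ^ i = d ^ l" "d ^ j = d ^ l" "2 * d ^ l = order"
      using le[OF assms(3)] le[OF assms(4)] N by linarith+
    then show ?thesis using base by simp
  qed
qed

text \<open>\<open>col i t\<close> is the color of the edges at position \<open>t\<close> on the cycles of generator \<open>d\<^sup>i\<close>. An edge of
  an involution has two starting points, between which the choice is arbitrary.\<close>

definition generator_color :: "(nat \<Rightarrow> nat \<Rightarrow> nat) \<Rightarrow> nat set \<Rightarrow> nat" where
  "generator_color col e =
     (let (i, v) = SOME (i, v). i \<le> l \<and> v < order \<and> e = {v, (v + d ^ i) mod order}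
      in col i (v div d ^ i))"

lemma generator_color_edge:
  assumes "\<And>t t'. i \<le> l \<Longrightarrow> 2 * d ^ i = order \<Longrightarrow> col i t = col i t'"
    and "i \<le> l" "v < order"
  shows "generator_color col {v, (v + d ^ i) mod order} = col i (v div d ^ i)"
proof -
  let ?P = "\<lambda>(j, w). j \<le> l \<and> w < order \<and> {v, (v + d ^ i) mod order} = {w, (w + d ^ j) mod order}"
  obtain j w where jw: "(SOME q. ?P q) = (j, w)" by fastforce
  have "?P (i, v)" using assms(2,3) by simp
  then have "?P (j, w)" unfolding jw[symmetric] by (rule someI)
  then have "i = j \<and> (v = w \<or> 2 * d ^ i = order)"
    using assms(2,3) generator_unique[of v w i j] by auto
  then show ?thesis
    unfolding generator_color_def jw using assms(1,2) by auto
qed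

text \<open>The position along the cycle grows by 1 with each step, also where the vertex labels wrap around,
  since \<open>col i\<close> has the cycle length \<open>N / d\<^sup>i\<close> as a period.\<close>

lemma walk_along_generator:
  assumes invol: "\<And>t t'. i \<le> l \<Longrightarrow> 2 * d ^ i = order \<Longrightarrow> col i t = col i t'"
    and period: "\<And>t. col i (t mod (n * d ^ (l - i))) = col i t"
    and "i \<le> l" "u < order"
  shows "\<exists>p. walk graph u p ((u + k * d ^ i) mod order) \<and>
    map (generator_color col) (path_edges p) = map (col i) [u div d ^ i..<u div d ^ i + k]"
proof (induction k)
  case 0
  then show ?case
    using assms(4) by (intro exI[of _ "[u]"]) (simp add: walk_def verts_graph)
next
  case (Suc k)
  define v where "v = (u + k * d ^ i) mod order"
  obtain p where p: "walk graph u p v"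
    "map (generator_color col) (path_edges p) = map (col i) [u div d ^ i..<u div d ^ i + k]"
    using Suc v_def by blast
  define w where "w = (v + d ^ i) mod order"
  have vw: "v < order" "w < order" unfolding v_def w_def using order_pos by auto
  have w: "w = (u + Suc k * d ^ i) mod order"
  proof -
    have "w = (u + k * d ^ i + d ^ i) mod order"
      unfolding w_def v_def by (rule mod_add_left_eq)
    then show ?thesis by (simp add: add_ac)
  qed
  have "walk graph v [v, w] w"
    using vw generator_edge[OF vw(1) assms(3)] by (simp add: walk_def verts_graph w_def)
  then obtain q where q: "walk graph u q w" "path_edges q = path_edges p @ path_edges [v, w]"
    using walk_append[OF p(1)] by blast
  have "order = d ^ i * (n * d ^ (l - i))"
    using assms(3) by (simp add: power_add[symmetric])
  moreover have "a mod (b * c) div b = (a div b) mod c" if "b > 0" for a b c :: nat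
    using that by (simp add: mod_mult2_eq)
  ultimately have "v div d ^ i = ((u + k * d ^ i) div d ^ i) mod (n * d ^ (l - i))"
    unfolding v_def using base by (simp only: zero_less_power)
  also have "(u + k * d ^ i) div d ^ i = u div d ^ i + k" using base by simp
  finally have "generator_color col {v, w} = col i (u div d ^ i + k)"
    unfolding w_def using generator_color_edge[of i col v, OF invol assms(3) vw(1)] period by simp
  then show ?case using p(2) q w by (intro exI[of _ q]) simp
qed

text \<open>A negative digit is walked from the other end.\<close>

lemma walk_along_generator_signed:
  assumes invol: "\<And>t t'. i \<le> l \<Longrightarrow> 2 * d ^ i = order \<Longrightarrow> col i t = col i t'"
    and period: "\<And>t. col i (t mod (n * d ^ (l - i))) = col i t"
    and i: "i \<le> l" and uv: "u < order" "v < order"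
    and target: "[int v = int u + z * int d ^ i] (mod int order)"
    and window: "\<And>t. inj_on (col i) {t..<t + nat \<bar>z\<bar>}"
  shows "\<exists>p. walk graph u p v \<and> path_length p = nat \<bar>z\<bar> \<and>
    distinct (map (generator_color col) (path_edges p)) \<and>
    generator_color col ` set (path_edges p) \<subseteq> range (col i)"
proof -
  have forward: "\<exists>p. walk graph a p b \<and> path_length p = k \<and>
      distinct (map (generator_color col) (path_edges p)) \<and>
      generator_color col ` set (path_edges p) \<subseteq> range (col i)"
    if ab: "a < order" "b < order" "[int b = int a + int k * int d ^ i] (mod int order)"
      and k: "k = nat \<bar>z\<bar>"
    for a b k
  proof -
    have "[b = a + k * d ^ i] (mod order)"
      using ab(3) by (simp flip: cong_int_iff)
    then have "b = (a + k * d ^ i) mod order"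
      using ab(2) by (simp add: cong_def)
    then obtain p where p: "walk graph a p b"
      "map (generator_color col) (path_edges p) = map (col i) [a div d ^ i..<a div d ^ i + k]"
      using walk_along_generator[of i col a k, OF invol period i ab(1)] by blast
    have "path_length p = k"
      using arg_cong[OF p(2), of length] by (simp add: path_length_def)
    moreover have "distinct (map (generator_color col) (path_edges p))"
      unfolding p(2) using window k by (simp add: distinct_map)
    moreover have "generator_color col ` set (path_edges p) \<subseteq> range (col i)"
      using arg_cong[OF p(2), of set] by auto
    ultimately show ?thesis using p(1) by blast
  qed
  show ?thesis
  proof (cases "z \<ge> 0")
    case True
    then have "[int v = int u + int (nat \<bar>z\<bar>) * int d ^ i] (mod int order)"
      using target by (simp del: of_nat_mult)
    then show ?thesis by (rule forward[OF uv _ refl])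
  next
    case False
    have "[int v + int (nat \<bar>z\<bar>) * int d ^ i = int u + z * int d ^ i + int (nat \<bar>z\<bar>) * int d ^ i] (mod int order)"
      using target by (intro cong_add cong_refl)
    then have "[int u = int v + int (nat \<bar>z\<bar>) * int d ^ i] (mod int order)"
      using False by (simp add: cong_sym_eq)
    from forward[OF uv(2,1) this refl] obtain p
      where "walk graph v p u" "path_length p = nat \<bar>z\<bar>"
      "distinct (map (generator_color col) (path_edges p))"
      "generator_color col ` set (path_edges p) \<subseteq> range (col i)"
      by blast
    then show ?thesis
      by (intro exI[of _ "rev p"])
         (simp add: walk_rev path_length_eq path_edges_rev rev_map[symmetric])
  qed
qed

lemma walk_of_digits:
  assumes invol: "\<And>i t t'. i \<le> l \<Longrightarrow> 2 * d ^ i = order \<Longrightarrow> col i t = col i t'"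
    and period: "\<And>i t. i \<le> l \<Longrightarrow> col i (t mod (n * d ^ (l - i))) = col i t"
    and window: "\<And>i t. i \<le> l \<Longrightarrow> inj_on (col i) {t..<t + nat \<bar>x i\<bar>}"
    and disjoint: "\<And>i j. i \<le> l \<Longrightarrow> j \<le> l \<Longrightarrow> i \<noteq> j \<Longrightarrow> x i \<noteq> 0 \<Longrightarrow> x j \<noteq> 0 \<Longrightarrow>
        range (col i) \<inter> range (col j) = {}"
    and "k \<le> Suc l" "u < order" "v < order" "[int v = int u + digit_value d k x] (mod int order)"
  shows "\<exists>p. walk graph u p v \<and> path_length p = digit_cost k x \<and>
    distinct (map (generator_color col) (path_edges p)) \<and>
    generator_color col ` set (path_edges p) \<subseteq> (\<Union>i\<in>{i. i < k \<and> x i \<noteq> 0}. range (col i))"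
  using assms(5-)
proof (induction k arbitrary: v)
  case 0
  then have "[int v = int u] (mod int order)" by (simp add: digit_value_def)
  then have "[v = u] (mod order)" by (simp only: cong_int_iff)
  then have "v = u" using 0 by (simp add: cong_def)
  then show ?case using 0
    by (intro exI[of _ "[u]"]) (simp add: walk_def verts_graph path_length_eq digit_cost_def)
next
  case (Suc k)
  have N: "0 < int order" using order_pos by linarith
  define w where "w = nat ((int u + digit_value d k x) mod int order)"
  have w: "w < order" "int w = (int u + digit_value d k x) mod int order"
    unfolding w_def using pos_mod_bound[OF N] pos_mod_sign[OF N] by (simp_all add: nat_less_iff del: of_nat_mult)
  then have wc: "[int w = int u + digit_value d k x] (mod int order)" by (simp add: cong_def del: of_nat_mult)
  then obtain p where p: "walk graph u p w" "path_length p = digit_cost k x"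
    "distinct (map (generator_color col) (path_edges p))"
    "generator_color col ` set (path_edges p) \<subseteq> (\<Union>i\<in>{i. i < k \<and> x i \<noteq> 0}. range (col i))"
    using Suc.IH[of w] Suc.prems w(1) by auto
  have k: "k \<le> l" using Suc.prems by simp
  have "[int u + digit_value d k x + x k * int d ^ k = int w + x k * int d ^ k] (mod int order)"
    using wc by (intro cong_add cong_refl) (rule cong_sym)
  then have "[int v = int w + x k * int d ^ k] (mod int order)"
    using Suc.prems(4) by (auto simp: digit_value_def add.assoc intro: cong_trans)
  then obtain q where q: "walk graph w q v" "path_length q = nat \<bar>x k\<bar>"
    "distinct (map (generator_color col) (path_edges q))"
    "generator_color col ` set (path_edges q) \<subseteq> range (col k)"
    using walk_along_generator_signed[of k col w v "x k", OF invol period[OF k] k w(1) Suc.prems(3) _ window[OF k]]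
    by blast
  obtain s where s: "walk graph u s v" "path_edges s = path_edges p @ path_edges q"
    using walk_append[OF p(1) q(1)] by blast
  have q_empty: "path_edges q = []" if "x k = 0"
    using q(2) that by (simp add: path_length_def)
  have "range (col i) \<inter> range (col k) = {}" if "x k \<noteq> 0" "i < k" "x i \<noteq> 0" for i
    using disjoint[of i k] k that by linarith
  then have "generator_color col ` set (path_edges p) \<inter> generator_color col ` set (path_edges q) = {}"
    using p(4) q(4) q_empty by (cases "x k = 0") (simp, blast)
  then have "distinct (map (generator_color col) (path_edges s))"
    using p(3) q(3) by (simp add: s(2))
  moreover have "path_length s = digit_cost (Suc k) x"
    using p(2) q(2) by (simp add: path_length_def s(2) digit_cost_def)
  moreover have "generator_color col ` set (path_edges s) \<subseteq>
      (\<Union>i\<in>{i. i < Suc k \<and> x i \<noteq> 0}. range (col i))" (is "_ \<subseteq> ?R")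
  proof -
    have "generator_color col ` set (path_edges p) \<subseteq> ?R"
      using p(4) by (rule subset_trans) (intro UN_mono, auto)
    moreover have "generator_color col ` set (path_edges q) \<subseteq> ?R"
    proof (cases "x k = 0")
      case False
      then have "range (col k) \<subseteq> ?R" by (intro UN_upper) simp
      with q(4) show ?thesis by (rule subset_trans)
    qed (simp add: q_empty)
    ultimately show ?thesis unfolding s(2) set_append image_Un by (rule Un_least)
  qed
  ultimately show ?case using s(1) by blast
qed

lemma src_le_of_generator_coloring:
  assumes colors: "\<And>i t. i \<le> l \<Longrightarrow> col i t \<in> {1..K}"
    and invol: "\<And>i t t'. i \<le> l \<Longrightarrow> 2 * d ^ i = order \<Longrightarrow> col i t = col i t'"
    and period: "\<And>i t. i \<le> l \<Longrightarrow> col i (t mod (n * d ^ (l - i))) = col i t"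
    and digits: "\<And>a. \<exists>x. optimal x a \<and>
        (\<forall>i\<le>l. \<forall>t. inj_on (col i) {t..<t + nat \<bar>x i\<bar>}) \<and>
        (\<forall>i\<le>l. \<forall>j\<le>l. i \<noteq> j \<longrightarrow> x i \<noteq> 0 \<longrightarrow> x j \<noteq> 0 \<longrightarrow> range (col i) \<inter> range (col j) = {})"
  shows "src graph \<le> K"
proof (rule src_le)
  show "edge_coloring graph K (generator_color col)"
    unfolding edge_coloring_def
  proof
    fix e assume "e \<in> edges graph"
    then obtain v i where vi: "v < order" "i \<le> l" and e: "e = {v, (v + d ^ i) mod order}"
      unfolding edges_graph by blast
    have "generator_color col e = col i (v div d ^ i)"
      unfolding e using generator_color_edge[of i col v, OF invol vi(2,1)] by blast
    then show "generator_color col e \<in> {1..K}" using colors[OF vi(2)] by metis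
  qed
  show "strong_rainbow_connecting graph (generator_color col)"
    unfolding strong_rainbow_connecting_def
  proof (intro ballI impI)
    fix u v assume "u \<in> verts graph" "v \<in> verts graph"
    then have uv: "u < order" "v < order" by (auto simp: verts_graph)
    obtain x where x: "optimal x (int v - int u)"
      and window: "\<forall>i\<le>l. \<forall>t. inj_on (col i) {t..<t + nat \<bar>x i\<bar>}"
      and disjoint: "\<forall>i\<le>l. \<forall>j\<le>l. i \<noteq> j \<longrightarrow> x i \<noteq> 0 \<longrightarrow> x j \<noteq> 0 \<longrightarrow>
        range (col i) \<inter> range (col j) = {}"
      using digits[of "int v - int u"] by (elim exE conjE)
    have "[int u + (int v - int u) = int u + digit_value d (Suc l) x] (mod int order)"
      using x unfolding optimal_def represents_def
      by (intro cong_add cong_refl) (rule cong_sym, blast)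
    then have "[int v = int u + digit_value d (Suc l) x] (mod int order)" by simp
    from walk_of_digits[of col x, OF invol period window[rule_format]
        disjoint[rule_format] order_refl uv this]
    obtain p where p: "walk graph u p v" "path_length p = digit_cost (Suc l) x"
      "distinct (map (generator_color col) (path_edges p))"
      by blast
    have shortest: "path_length p \<le> path_length q" if "walk graph u q v" for q
      using digits_of_walk[OF that] x unfolding p(2) optimal_def by (meson order_trans)
    show "\<exists>p. is_path graph u p v \<and> rainbow_path (generator_color col) p \<and>
        path_length p = graph_dist graph u v"
      using shortest_walk_is_path[OF p(1) shortest] p(3) unfolding rainbow_path_def by blast
  qed
qed

end

section \<open>Colorings of a cycle with distinct colors on short arcs\<close>

text \<open>A coloring, with \<open>K\<close> colors, of the positions on a cycle of length \<open>n\<close> in which any \<open>h\<close>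
  consecutive positions have distinct colors.\<close>

definition cyclic_window :: "nat \<Rightarrow> nat \<Rightarrow> nat \<Rightarrow> (nat \<Rightarrow> nat) \<Rightarrow> bool" where
  "cyclic_window n h K f \<longleftrightarrow>
     (\<forall>t. f t < K) \<and> (\<forall>t. f (t mod n) = f t) \<and> (\<forall>t. inj_on f {t..<t + h})"

lemma mod_shift_neq:
  fixes u \<delta> h :: nat
  assumes "0 < \<delta>" "\<delta> < h"
  shows "u mod h \<noteq> (u + \<delta>) mod h"
proof
  assume "u mod h = (u + \<delta>) mod h"
  then have "h dvd (u + \<delta>) - u" by (metis le_add1 mod_eq_dvd_iff_nat)
  then show False using assms by (auto dest: dvd_imp_le)
qed

lemma inj_on_window:
  assumes "\<And>a \<delta>. 0 < \<delta> \<Longrightarrow> \<delta> < h \<Longrightarrow> f a \<noteq> f (a + \<delta>)"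
  shows "inj_on f {t..<t + h :: nat}"
proof (rule linorder_inj_onI)
  fix a b assume "a < b" "a \<in> {t..<t + h}" "b \<in> {t..<t + h}"
  then show "f a \<noteq> f b" using assms[of "b - a" a] by auto
qed auto

lemma cyclic_window_mod:
  assumes "K > 0" "K dvd n" "h \<le> K"
  shows "cyclic_window n h K (\<lambda>t. t mod K)"
  unfolding cyclic_window_def using assms
  by (auto simp: mod_mod_cancel intro!: inj_on_window dest: mod_shift_neq[of _ K])

text \<open>The cycle is cut into \<open>q - 1\<close> blocks of length \<open>h\<close> and a last one of length \<open>h + s\<close>, each
  colored \<open>0, 1, 2, \<dots>\<close> in order. An arc of length \<open>h\<close> meets at most two consecutive blocks; as the
  first of them has length at least \<open>h\<close>, the arc leaves it at colors beyond those it reaches in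
  the second.\<close>

lemma cyclic_window_remainder:
  assumes n: "n = q * h + s" and "q \<ge> 1" "h \<ge> 1"
  shows "\<exists>f. cyclic_window n h (h + s) f"
proof -
  define g where "g u = (if u < q * h then u mod h else h + (u - q * h))" for u
  define f where "f t = g (t mod n)" for t
  have qh: "h \<le> q * h" "0 < q * h" using assms(2,3) by auto
  have "n > 0" using qh n by simp
  have "f a \<noteq> f (a + \<delta>)" if \<delta>: "0 < \<delta>" "\<delta> < h" for a \<delta>
  proof -
    define u where "u = a mod n"
    have u: "u < n" unfolding u_def using \<open>n > 0\<close> by simp
    have b: "(a + \<delta>) mod n = (u + \<delta>) mod n" unfolding u_def by (simp add: mod_add_left_eq)
    show ?thesis
    proof (cases "u + \<delta> < n")
      case True
      then have "(a + \<delta>) mod n = u + \<delta>" using b by simp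
      moreover define c where "c = u mod h"
      moreover have "c < h" unfolding c_def using assms(3) by simp
      ultimately show ?thesis
        using mod_shift_neq[OF \<delta>, of u] \<delta>
        unfolding f_def g_def u_def[symmetric] c_def[symmetric] by auto
    next
      case False
      define w where "w = u + \<delta> - n"
      have w: "w < h" "w < n" "u + \<delta> = w + n" unfolding w_def using u \<delta> False qh n by linarith+
      then have "w < q * h" using qh(1) by linarith
      with w have fw: "f (a + \<delta>) = w"
        unfolding f_def g_def b by simp
      have "u mod h \<noteq> w" if "u < q * h"
      proof
        assume "u mod h = w"
        then have "u = u div h * h + w" by (metis div_mult_mod_eq)
        moreover have "u div h < q" using that by (simp add: less_mult_imp_div_less)
        then have "Suc (u div h) * h \<le> q * h" by (intro mult_right_mono) auto
        ultimately show False using w(3) \<delta> n by simp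
      qed
      then show ?thesis using fw w(1) unfolding f_def g_def u_def[symmetric] by auto
    qed
  qed
  moreover have "f t < h + s" for t
  proof -
    have "t mod n < n" "t mod n mod h < h" using \<open>n > 0\<close> assms(3) by simp_all
    then show ?thesis unfolding f_def g_def using n by auto
  qed
  ultimately have "cyclic_window n h (h + s) f"
    unfolding cyclic_window_def by (auto simp: f_def intro!: inj_on_window)
  then show ?thesis by blast
qed

lemma level_window_even:
  assumes "even d" "d \<ge> 2" "k \<ge> 1"
  shows "\<exists>f. cyclic_window (r * d ^ k) (d div 2) (d div 2) f"
proof -
  have "d div 2 dvd d" using assms(1) by (elim evenE) simp
  also have "d dvd r * d ^ k" using assms(3) by (intro dvd_mult dvd_power) simp
  finally show ?thesis using cyclic_window_mod[of "d div 2" _ "d div 2"] assms(2) by auto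
qed

lemma level_window_multiple:
  assumes "r \<ge> 1" "d div 2 \<le> r"
  shows "\<exists>f. cyclic_window (r * d ^ k) (d div 2) r f"
  using cyclic_window_mod[of r "r * d ^ k" "d div 2"] assms by auto

text \<open>Since \<open>d = 2 h + 1 \<equiv> 1\<close> modulo \<open>h\<close>, the remainder of \<open>r d\<^sup>k\<close> is \<open>r\<close>.\<close>

lemma level_window_small:
  assumes "odd d" "r < d div 2" "1 \<le> r" "k \<ge> 1"
  shows "\<exists>f. cyclic_window (r * d ^ k) (d div 2) (d div 2 + r) f"
proof -
  define h where "h = d div 2"
  have d: "d = 2 * h + 1" unfolding h_def using assms(1) by simp
  have "[2 * h + 1 = 0 + 1] (mod h)" by (intro cong_add cong_refl) (simp add: cong_0_iff)
  then have "[2 * h + 1 = 1] (mod h)" by simp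
  then have "[r * d ^ k = r * 1 ^ k] (mod h)"
    unfolding d by (intro cong_mult cong_pow cong_refl)
  then have "(r * d ^ k) mod h = r" using assms(2) by (simp add: cong_def h_def)
  then have n: "r * d ^ k = (r * d ^ k) div h * h + r" by (metis div_mult_mod_eq)
  have "h \<le> d ^ k" using self_le_power[of d k] d assms(4) by linarith
  also have "\<dots> \<le> r * d ^ k" using assms(3) by simp
  finally have "(r * d ^ k) div h \<ge> 1"
    using assms(2) unfolding h_def[symmetric] by (simp add: div_greater_zero_iff Suc_le_eq)
  then show ?thesis
    using cyclic_window_remainder[OF n] assms(2) unfolding h_def[symmetric] by auto
qed

text \<open>The number of colors for the cycles of length \<open>r\<close> of the last generator. For \<open>r = 3\<close> a digit of
  absolute value at most 1 needs a single color, one less than \<open>\<lceil>3/2\<rceil>\<close>; for \<open>r = 1\<close> there is no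
  such generator.\<close>

definition top_colors :: "nat \<Rightarrow> nat" where
  "top_colors r = (if r \<ge> 4 then (r + 1) div 2 else r div 2)"

lemma top_window:
  assumes "r \<ge> 2"
  shows "\<exists>f. cyclic_window r (r div 2) (top_colors r) f"
proof (cases "r \<ge> 4 \<and> odd r")
  case True
  then have "r = 2 * (r div 2) + 1" "1 \<le> r div 2" by presburger+
  from cyclic_window_remainder[OF this(1) _ this(2)] show ?thesis
    using True by (simp add: top_colors_def)
next
  case False
  then have "top_colors r = r div 2" by (auto simp: top_colors_def elim: evenE)
  moreover have "r div 2 dvd r"
  proof (cases "even r")
    case False
    then have "r = 3" using \<open>\<not> (r \<ge> 4 \<and> odd r)\<close> assms by (cases "r = 2") auto
    then show ?thesis by simp
  qed (auto elim: evenE)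
  ultimately show ?thesis
    using cyclic_window_mod[of "r div 2" r "r div 2"] assms by auto
qed

section \<open>Bounds for recursive circulants\<close>

text \<open>Generator \<open>d\<^sup>i\<close> uses the palette \<open>K i + 1, \<dots>, K i + K\<close>, with \<open>T\<close> instead of \<open>K\<close>
  colors at the top. The only possible involution is the
  last generator for \<open>n = 2\<close>, which is therefore required to have a single color.\<close>

lemma (in circulant_digits) src_le_of_windows:
  assumes "d \<ge> 3"
    and low: "\<And>i. i < l \<Longrightarrow> \<exists>f. cyclic_window (n * d ^ (l - i)) (d div 2) K f"
    and top: "\<exists>f. cyclic_window n (n div 2) T f" and invol: "n = 2 \<Longrightarrow> T = 1"
  shows "src graph \<le> K * l + T"
proof -
  obtain F where F: "\<And>i. i < l \<Longrightarrow> cyclic_window (n * d ^ (l - i)) (d div 2) K (F i)"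
    using low by metis
  obtain g where g: "cyclic_window n (n div 2) T g" using top by blast
  define col where "col i t = Suc (K * i + (if i < l then F i t else g t))" for i t
  have lower: "K * i < col i t" for i t unfolding col_def by simp
  have upper: "col i t \<le> K * Suc i" if "i < l" for i t
  proof -
    have "F i t < K" using F[OF that] unfolding cyclic_window_def by blast
    then show ?thesis using that by (simp add: col_def)
  qed
  have disjoint: "range (col i) \<inter> range (col j) = {}" if ij: "i < j" "j \<le> l" for i j
  proof -
    have "col i t \<noteq> col j t'" for t t'
    proof -
      have "col i t \<le> K * Suc i" using upper ij by simp
      also have "\<dots> \<le> K * j" using ij by (intro mult_left_mono) auto
      also have "\<dots> < col j t'" by (rule lower)
      finally show ?thesis by simp
    qed
    then show ?thesis by blast
  qed
  show ?thesis
  proof (rule src_le_of_generator_coloring[where col = col])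
    fix i t assume i: "i \<le> l"
    show "col i t \<in> {1..K * l + T}"
    proof (cases "i < l")
      case True
      then have "col i t \<le> K * Suc i" by (rule upper)
      also have "\<dots> \<le> K * l" using True by (intro mult_left_mono) auto
      finally show ?thesis using lower[of i t] by simp
    next
      case False
      moreover have "g t < T" using g unfolding cyclic_window_def by blast
      ultimately show ?thesis using i by (simp add: col_def)
    qed
    show "col i (t mod (n * d ^ (l - i))) = col i t"
    proof (cases "i < l")
      case True
      then have "F i (t mod (n * d ^ (l - i))) = F i t"
        using F unfolding cyclic_window_def by blast
      then show ?thesis using True by (simp only: col_def if_True)
    next
      case False
      have "g (t mod n) = g t" using g unfolding cyclic_window_def by blast
      then show ?thesis using False i by (simp add: col_def)
    qed
  next
    fix i t t' assume i: "i \<le> l" and two: "2 * d ^ i = n * d ^ l"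
    have "d ^ l = d ^ i * d ^ (l - i)" using i by (simp add: power_add[symmetric])
    then have prod: "n * d ^ (l - i) = 2" using two base by simp
    have "\<not> i < l"
    proof
      assume "i < l"
      then have "3 \<le> d ^ (l - i)" using self_le_power[of d "l - i"] assms(1) by linarith
      then have "1 * 3 \<le> n * d ^ (l - i)" using top_order by (intro mult_mono) auto
      then show False using prod by simp
    qed
    then have "i = l" "n = 2" using i prod by auto
    moreover have "g t < T" "g t' < T" using g unfolding cyclic_window_def by blast+
    ultimately show "col i t = col i t'" using invol by (simp add: col_def)
  next
    fix a
    obtain x where x: "optimal x a" "\<forall>i<l. \<bar>x i\<bar> \<le> int (d div 2)" "\<bar>x l\<bar> \<le> int (n div 2)"
      using optimal_bounded_digits by blast
    have "inj_on (col i) {t..<t + nat \<bar>x i\<bar>}" if i: "i \<le> l" for i t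
    proof (cases "i < l")
      case True
      then have "inj_on (F i) {t..<t + d div 2}" using F unfolding cyclic_window_def by blast
      then have "inj_on (F i) {t..<t + nat \<bar>x i\<bar>}"
        by (rule inj_on_subset) (use x(2) True in fastforce)
      then show ?thesis using True by (simp add: col_def inj_on_def)
    next
      case False
      have "inj_on g {t..<t + n div 2}" using g unfolding cyclic_window_def by blast
      then have "inj_on g {t..<t + nat \<bar>x l\<bar>}"
        by (rule inj_on_subset) (use x(3) in fastforce)
      then show ?thesis using False i by (simp add: col_def inj_on_def)
    qed
    moreover have "range (col i) \<inter> range (col j) = {}" if "i \<le> l" "j \<le> l" "i \<noteq> j" for i j
      using disjoint[of i j] disjoint[of j i] that by (metis Int_commute nat_neq_iff)
    ultimately show "\<exists>x. optimal x a \<and>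
        (\<forall>i\<le>l. \<forall>t. inj_on (col i) {t..<t + nat \<bar>x i\<bar>}) \<and>
        (\<forall>i\<le>l. \<forall>j\<le>l. i \<noteq> j \<longrightarrow> x i \<noteq> 0 \<longrightarrow> x j \<noteq> 0 \<longrightarrow> range (col i) \<inter> range (col j) = {})"
      using x(1) by (intro exI[of _ x]) simp
  qed
qed

lemma src_rec_circulant_le:
  assumes "d \<ge> 3" "m \<ge> 1" "1 \<le> r" "r < d"
    and low: "\<And>k. k \<ge> 1 \<Longrightarrow> \<exists>f. cyclic_window (r * d ^ k) (d div 2) K f"
  shows "src (rec_circulant (r * d ^ m) d) \<le> K * m + top_colors r"
proof (cases "r = 1")
  case True
  interpret circulant_digits d d "m - 1"
    by unfold_locales (use assms in auto)
  have N: "d * d ^ (m - 1) = d ^ m" using assms(2) by (simp add: power_eq_if)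
  have "src (rec_circulant (d * d ^ (m - 1)) d) \<le> K * (m - 1) + K"
  proof (rule src_le_of_windows[OF assms(1)])
    show "\<exists>f. cyclic_window (d * d ^ (m - 1 - i)) (d div 2) K f" for i
      using low[of "Suc (m - 1 - i)"] True by simp
    show "\<exists>f. cyclic_window d (d div 2) K f" using low[of 1] True by simp
  qed (use assms in auto)
  also have "K * (m - 1) + K = K * m" using assms(2) by (cases m) auto
  finally show ?thesis using True N by (simp add: top_colors_def)
next
  case False
  interpret circulant_digits d r m
    by unfold_locales (use assms False in auto)
  show ?thesis
  proof (rule src_le_of_windows[OF assms(1) _ top_window])
    show "\<exists>f. cyclic_window (r * d ^ (m - i)) (d div 2) K f" if "i < m" for i
      using low[of "m - i"] that by simp
  qed (use top_order in \<open>auto simp: top_colors_def\<close>)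
qed

lemma le_rc_rec_circulant:
  assumes "odd d" "m \<ge> 1" "1 \<le> r" "r < d"
  shows "(d div 2) * m + r div 2 \<le> rc (rec_circulant (r * d ^ m) d)"
proof (cases "r = 1")
  case True
  interpret circulant_digits d d "m - 1"
    by unfold_locales (use assms in auto)
  have "d * d ^ (m - 1) = d ^ m" using assms(2) by (simp add: power_eq_if)
  moreover have "(d div 2) * (m - 1) + d div 2 \<le> rc (rec_circulant (d * d ^ (m - 1)) d)"
    using expensive_residue[OF assms(1)] le_rc_of_expensive_residue by metis
  moreover have "(d div 2) * (m - 1) + d div 2 = (d div 2) * m" using assms(2) by (cases m) auto
  ultimately show ?thesis using True by simp
next
  case False
  interpret circulant_digits d r m
    by unfold_locales (use assms False in auto)
  show ?thesis
    using expensive_residue[OF assms(1)] le_rc_of_expensive_residue by metis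
qed

lemma rc_le_src_rec_circulant:
  "d \<ge> 2 \<Longrightarrow> rc (rec_circulant N d) \<le> src (rec_circulant N d)"
  by (intro rc_le_src simple_graph_rec_circulant connected_rec_circulant)

text \<open>Generators \<open>2\<^sup>2\<^sup>j\<close> and \<open>2\<^sup>2\<^sup>j\<^sup>+\<^sup>1\<close> share color \<open>j + 1\<close>: a non-adjacent expansion uses at most
  one of them, and that one only once.\<close>

lemma (in circulant_digits) src_binary_le:
  assumes "d = 2"
  shows "src graph \<le> Suc (l div 2)"
proof (rule src_le_of_generator_coloring[where col = "\<lambda>i _. Suc (i div 2)"])
  fix a
  obtain x where x: "optimal x a" "\<forall>i\<le>l. \<bar>x i\<bar> \<le> 1" "\<forall>i<l. x i = 0 \<or> x (Suc i) = 0"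
    using optimal_non_adjacent[OF assms] by blast
  have "inj_on (\<lambda>_. Suc (i div 2)) {t..<t + nat \<bar>x i\<bar>}" if "i \<le> l" for i t
    using x(2)[rule_format, OF that] by (auto simp: inj_on_def)
  moreover have "i div 2 \<noteq> j div 2" if ij: "i \<le> l" "j \<le> l" "i \<noteq> j" "x i \<noteq> 0" "x j \<noteq> 0" for i j
  proof
    assume "i div 2 = j div 2"
    then have "j = Suc i \<or> i = Suc j" using ij(3) by presburger
    then show False using x(3) ij by (auto simp: Suc_le_eq)
  qed
  ultimately show "\<exists>x. optimal x a \<and>
      (\<forall>i\<le>l. \<forall>t. inj_on (\<lambda>_. Suc (i div 2)) {t..<t + nat \<bar>x i\<bar>}) \<and>
      (\<forall>i\<le>l. \<forall>j\<le>l. i \<noteq> j \<longrightarrow> x i \<noteq> 0 \<longrightarrow> x j \<noteq> 0 \<longrightarrow>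
        range (\<lambda>_::nat. Suc (i div 2)) \<inter> range (\<lambda>_::nat. Suc (j div 2)) = {})"
    using x(1) by (intro exI[of _ x]) simp
qed (auto simp: div_le_mono)

lemma binary_bounds:
  assumes "m \<ge> 1"
  shows "m div 2 \<le> rc (rec_circulant (2 ^ m) 2)" "src (rec_circulant (2 ^ m) 2) \<le> (m + 1) div 2"
proof -
  interpret circulant_digits 2 2 "m - 1" by unfold_locales auto
  have N: "2 * 2 ^ (m - 1) = (2::nat) ^ m" using assms by (simp add: power_eq_if)
  have "Suc (m - 1) div 2 \<le> rc (rec_circulant (2 * 2 ^ (m - 1)) 2)"
    using expensive_residue_binary[OF refl] le_rc_of_expensive_residue by metis
  then show "m div 2 \<le> rc (rec_circulant (2 ^ m) 2)" using assms N by simp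
  have "Suc ((m - 1) div 2) = (m + 1) div 2" using assms by (cases m) auto
  then show "src (rec_circulant (2 ^ m) 2) \<le> (m + 1) div 2" using src_binary_le[OF refl] N by simp
qed

lemma nat_ceiling_half: "nat \<lceil>real r / 2\<rceil> = (r + 1) div 2"
proof (cases "even r")
  case False
  then obtain k where k: "r = 2 * k + 1" by (elim oddE)
  have "\<lceil>real r / 2\<rceil> = int k + 1"
    by (rule ceiling_unique) (simp_all add: k field_simps)
  then show ?thesis by (simp add: k nat_add_distrib)
qed (auto elim!: evenE)

theorem theorem3:
  fixes d m r :: nat
  assumes "d \<ge> 2" and "m \<ge> 1" and "1 \<le> r" and "r < d"
  shows
    "(r \<ge> 4 \<and> d \<ge> 5 \<longrightarrow>
        rc (rec_circulant (r * d ^ m) d) \<le> src (rec_circulant (r * d ^ m) d) \<and>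
        (even d \<longrightarrow>
          src (rec_circulant (r * d ^ m) d) \<le> (d div 2) * m + nat \<lceil>real r / 2\<rceil>) \<and>
        (odd d \<and> r = d div 2 \<longrightarrow>
          src (rec_circulant (r * d ^ m) d) \<le> (d div 2) * m + nat \<lceil>real r / 2\<rceil>) \<and>
        (odd d \<and> r < d div 2 \<longrightarrow>
          src (rec_circulant (r * d ^ m) d) \<le> (d div 2 + r) * m + nat \<lceil>real r / 2\<rceil>) \<and>
        (odd d \<and> r > d div 2 \<longrightarrow>
          src (rec_circulant (r * d ^ m) d) \<le> r * m + nat \<lceil>real r / 2\<rceil>) \<and>
        (d = 2 * r + 1 \<and> even r \<longrightarrow>
          rc (rec_circulant (r * d ^ m) d) = src (rec_circulant (r * d ^ m) d) \<and>
          src (rec_circulant (r * d ^ m) d) = r * m + r div 2)) \<and>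
     (r \<le> 3 \<and> d \<ge> 4 \<longrightarrow>
        rc (rec_circulant (r * d ^ m) d) \<le> src (rec_circulant (r * d ^ m) d) \<and>
        (even d \<longrightarrow>
          src (rec_circulant (r * d ^ m) d) \<le> (d div 2) * m + r div 2) \<and>
        (odd d \<and> r = d div 2 \<longrightarrow>
          src (rec_circulant (r * d ^ m) d) \<le> (d div 2) * m + r div 2) \<and>
        (odd d \<and> r < d div 2 \<longrightarrow>
          src (rec_circulant (r * d ^ m) d) \<le> (d div 2 + r) * m + r div 2) \<and>
        (odd d \<and> r > d div 2 \<longrightarrow>
          src (rec_circulant (r * d ^ m) d) \<le> r * m + r div 2) \<and>
        (r = 3 \<and> d = 7 \<longrightarrow>
          rc (rec_circulant (r * d ^ m) d) = src (rec_circulant (r * d ^ m) d) \<and>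
          src (rec_circulant (r * d ^ m) d) = 3 * m + 1)) \<and>
     (d = 3 \<longrightarrow>
        rc (rec_circulant (r * 3 ^ m) 3) = src (rec_circulant (r * 3 ^ m) 3) \<and>
        src (rec_circulant (r * 3 ^ m) 3) = m + r div 2) \<and>
     (d = 2 \<longrightarrow>
        m div 2 \<le> rc (rec_circulant (2 ^ m) 2) \<and>
        rc (rec_circulant (2 ^ m) 2) \<le> src (rec_circulant (2 ^ m) 2) \<and>
        src (rec_circulant (2 ^ m) 2) \<le> nat \<lceil>real m / 2\<rceil> \<and>
        (even m \<longrightarrow>
          rc (rec_circulant (2 ^ m) 2) = src (rec_circulant (2 ^ m) 2) \<and>
          src (rec_circulant (2 ^ m) 2) = m div 2))"
proof -
  have rc_src: "rc (rec_circulant N d) \<le> src (rec_circulant N d)" for N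
    using rc_le_src_rec_circulant assms(1) .
  let ?G = "rec_circulant (r * d ^ m) d"
  have even: "src ?G \<le> (d div 2) * m + top_colors r" if "d \<ge> 3" "even d"
    using src_rec_circulant_le[OF that(1) assms(2-4)] level_window_even[OF that(2) assms(1)] by blast
  have large: "src ?G \<le> r * m + top_colors r" if "d \<ge> 3" "d div 2 \<le> r"
    using src_rec_circulant_le[OF that(1) assms(2-4)] level_window_multiple[OF assms(3) that(2)] by blast
  have small: "src ?G \<le> (d div 2 + r) * m + top_colors r" if "d \<ge> 3" "odd d" "r < d div 2"
    using src_rec_circulant_le[OF that(1) assms(2-4)] level_window_small[OF that(2,3) assms(3)] by blast
  have lower: "(d div 2) * m + r div 2 \<le> rc ?G" if "odd d"
    using le_rc_rec_circulant[OF that assms(2-4)] .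
  \<comment> \<open>For \<open>d = 3\<close> all digits are at most 1, so one color per generator suffices for every \<open>r\<close>.\<close>
  have ternary: "src ?G \<le> 1 * m + top_colors r" if "d = 3"
  proof (rule src_rec_circulant_le[OF _ assms(2-4)])
    show "\<exists>f. cyclic_window (r * d ^ k) (d div 2) 1 f" for k
      using cyclic_window_mod[of 1 "r * d ^ k" "d div 2"] that by auto
  qed (use that in simp)
  show ?thesis
  proof (intro conjI impI; (elim conjE)?)
    assume "d = 2 * r + 1" "even r" "r \<ge> 4" "d \<ge> 5"
    then have "src ?G \<le> r * m + r div 2" "r * m + r div 2 \<le> rc ?G"
      using large lower by (simp_all add: top_colors_def)
    then show "rc ?G = src ?G" "src ?G = r * m + r div 2" using rc_src[of "r * d ^ m"] by linarith+
  next
    assume "r = 3" "d = 7"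
    then have "src ?G \<le> 3 * m + 1" "3 * m + 1 \<le> rc ?G"
      using large lower by (simp_all add: top_colors_def)
    then show "rc ?G = src ?G" "src ?G = 3 * m + 1" using rc_src[of "r * d ^ m"] by linarith+
  next
    assume d: "d = 3"
    then have "src ?G \<le> m + r div 2" "m + r div 2 \<le> rc ?G"
      using ternary lower assms(4) by (simp_all add: top_colors_def)
    then show "rc (rec_circulant (r * 3 ^ m) 3) = src (rec_circulant (r * 3 ^ m) 3)"
      "src (rec_circulant (r * 3 ^ m) 3) = m + r div 2"
      using rc_src[of "r * d ^ m"] unfolding d by linarith+
  next
    assume "d = 2"
    then have le: "rc (rec_circulant (2 ^ m) 2) \<le> src (rec_circulant (2 ^ m) 2)" using rc_src by blast
    show "m div 2 \<le> rc (rec_circulant (2 ^ m) 2)"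
      "rc (rec_circulant (2 ^ m) 2) \<le> src (rec_circulant (2 ^ m) 2)"
      "src (rec_circulant (2 ^ m) 2) \<le> nat \<lceil>real m / 2\<rceil>"
      using binary_bounds[OF assms(2)] le by (simp_all add: nat_ceiling_half)
    assume "even m"
    then have "(m + 1) div 2 = m div 2" by simp
    then show "rc (rec_circulant (2 ^ m) 2) = src (rec_circulant (2 ^ m) 2)"
      "src (rec_circulant (2 ^ m) 2) = m div 2"
      using binary_bounds[OF assms(2)] le by linarith+
  qed (use rc_src even large small in \<open>auto simp: nat_ceiling_half top_colors_def\<close>)
qed

end
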